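(* Assume that $G$ is a hyperbolic group and $H$ is a quasiretract of $G$. Then the subgroup $H$ is quasiconvex in $G$.
   Context: Hyperbolic means Gromov (word) hyperbolic. Fix a finite symmetrized generating set of $G$. A subset of $G$ is quasiconvex if for some $\eta\ge0$ every geodesic segment in the Cayley graph of $G$ joining two elements of the subset lies in the closed $\eta$-neighborhood of the subset (in a hyperbolic group this does not depend on the generating set). A subgroup $H$ of a group $G$ is called a quasiretract of $G$ if there exists a normal subgroup $N\lhd G$ such that $|G:HN|<\infty$ and the intersection $H\cap N$ is finite. *)

theory Defs
  imports Complex_Main "HOL-Algebra.Generated_Groups"
begin

definition symmetrized_generating_set :: "('a, 'b) monoid_scheme \<Rightarrow> 'a set \<Rightarrow> bool" where
  "symmetrized_generating_set G S \<longleftrightarrow>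
     S \<subseteq> carrier G \<and> (\<forall>s\<in>S. inv\<^bsub>G\<^esub> s \<in> S) \<and> generate G S = carrier G"

(* The Cayley graph is represented by its adjacency relation on the vertex set carrier G. For a
   symmetrized S the relation is symmetric. *)
definition cayley_graph :: "('a, 'b) monoid_scheme \<Rightarrow> 'a set \<Rightarrow> ('a \<times> 'a) set" where
  "cayley_graph G S = {(g, g \<otimes>\<^bsub>G\<^esub> s) | g s. g \<in> carrier G \<and> s \<in> S}"

(* The graph distance, i.e. the word metric of S. It is meaningful only if S generates G, since
   otherwise LEAST may range over an empty set; all uses below are for generating S. *)
definition cayley_dist :: "('a, 'b) monoid_scheme \<Rightarrow> 'a set \<Rightarrow> 'a \<Rightarrow> 'a \<Rightarrow> nat" where
  "cayley_dist G S x y = (LEAST n. (x, y) \<in> cayley_graph G S ^^ n)"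

(* A geodesic segment between two elements of G is an edge path of minimal length; it is given by
   the list of the vertices it visits, so that its length is one less than that of the list. *)
definition cayley_geodesic ::
    "('a, 'b) monoid_scheme \<Rightarrow> 'a set \<Rightarrow> 'a \<Rightarrow> 'a list \<Rightarrow> 'a \<Rightarrow> bool" where
  "cayley_geodesic G S x p y \<longleftrightarrow>
     p \<noteq> [] \<and> set p \<subseteq> carrier G \<and> hd p = x \<and> last p = y \<and>
     successively (\<lambda>u v. (u, v) \<in> cayley_graph G S) p \<and>
     length p = Suc (cayley_dist G S x y)"

definition gromov_product :: "('a \<Rightarrow> 'a \<Rightarrow> real) \<Rightarrow> 'a \<Rightarrow> 'a \<Rightarrow> 'a \<Rightarrow> real" where
  "gromov_product d e x y = (d e x + d e y - d x y) / 2"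

definition gromov_hyperbolic_on :: "'a set \<Rightarrow> ('a \<Rightarrow> 'a \<Rightarrow> real) \<Rightarrow> bool" where
  "gromov_hyperbolic_on M d \<longleftrightarrow>
     (\<exists>\<delta>\<ge>0. \<forall>e\<in>M. \<forall>x\<in>M. \<forall>y\<in>M. \<forall>z\<in>M.
        gromov_product d e x z \<ge> min (gromov_product d e x y) (gromov_product d e y z) - \<delta>)"

definition hyperbolic_group :: "('a, 'b) monoid_scheme \<Rightarrow> bool" where
  "hyperbolic_group G \<longleftrightarrow> group G \<and>
     (\<exists>S. finite S \<and> symmetrized_generating_set G S \<and>
        gromov_hyperbolic_on (carrier G) (\<lambda>x y. real (cayley_dist G S x y)))"

definition closed_nbhd :: "('a, 'b) monoid_scheme \<Rightarrow> 'a set \<Rightarrow> real \<Rightarrow> 'a set \<Rightarrow> 'a set" where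
  "closed_nbhd G S \<eta> Q = {x \<in> carrier G. \<exists>q\<in>Q. real (cayley_dist G S x q) \<le> \<eta>}"

(* Restricting the neighborhood condition to the vertices of a geodesic is harmless: a point inside
   an edge is at distance at most 1/2 from a vertex of that edge, and eta is arbitrary. *)
definition quasiconvex :: "('a, 'b) monoid_scheme \<Rightarrow> 'a set \<Rightarrow> 'a set \<Rightarrow> bool" where
  "quasiconvex G S Q \<longleftrightarrow> Q \<subseteq> carrier G \<and>
     (\<exists>\<eta>\<ge>0. \<forall>x\<in>Q. \<forall>y\<in>Q. \<forall>p. cayley_geodesic G S x p y \<longrightarrow> set p \<subseteq> closed_nbhd G S \<eta> Q)"

definition quasiretract :: "('a, 'b) monoid_scheme \<Rightarrow> 'a set \<Rightarrow> bool" where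
  "quasiretract G H \<longleftrightarrow> subgroup H G \<and>
     (\<exists>N. N \<lhd> G \<and> finite (rcosets\<^bsub>G\<^esub> (H <#>\<^bsub>G\<^esub> N)) \<and> finite (H \<inter> N))"

end

theory Submission
  imports Defs "HOL-Algebra.Zassenhaus" "HOL-Analysis.Abstract_Metric_Spaces" "HOL-Real_Asymp.Real_Asymp"
begin

text \<open>The decomposition \<open>g = h n t\<close>, with \<open>t\<close> in a finite transversal of \<open>H N\<close>, makes
  \<open>g \<mapsto> h\<close> a coarsely Lipschitz retraction of \<open>G\<close> onto \<open>H\<close>. Hence \<open>H\<close> is undistorted: two
  of its points are joined inside \<open>H\<close> by a chain of bounded steps whose length is linear in their
  distance. In a hyperbolic space geodesics between points of an undistorted set stay close to it.
  The metric of the given generating set \<open>S\<close> need not be the hyperbolic one, but an \<open>S\<close>-geodesic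
  \<open>q\<close> is itself undistorted in the hyperbolic metric. So a hyperbolic geodesic with the same end
  points as \<open>q\<close> is close to \<open>H\<close> and to \<open>q\<close>; by discrete continuity \<open>q\<close> is then close to it,
  and therefore close to \<open>H\<close>.\<close>

section \<open>Undistorted sets, discrete geodesics and a growth estimate\<close>

text \<open>One constant bounds both the steps of a chain and the ratio of its length to the
  distance, so that a single number runs through all estimates.\<close>

definition undistorted :: "('a \<Rightarrow> 'a \<Rightarrow> real) \<Rightarrow> real \<Rightarrow> 'a set \<Rightarrow> bool" where
  "undistorted d L A \<longleftrightarrow> (\<forall>a\<in>A. \<forall>b\<in>A. \<exists>c n. c 0 = a \<and> c n = b \<and> c ` {..n} \<subseteq> A \<and>
     (\<forall>i<n. d (c i) (c (Suc i)) \<le> L) \<and> real n \<le> L * d a b)"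

definition geodesic_path :: "('a \<Rightarrow> 'a \<Rightarrow> real) \<Rightarrow> nat \<Rightarrow> (nat \<Rightarrow> 'a) \<Rightarrow> bool" where
  "geodesic_path d n \<gamma> \<longleftrightarrow> (\<forall>i\<le>n. \<forall>j\<le>n. d (\<gamma> i) (\<gamma> j) = \<bar>real i - real j\<bar>)"

text \<open>A linear function outgrows a logarithmic one. The inequality is the one that
  \<open>geodesic_near_undistorted\<close> derives for its radius \<open>R\<close>.\<close>

lemma linear_le_log_imp_bounded:
  assumes "0 \<le> (L::real)" "0 \<le> (\<delta>::real)"
  shows "\<exists>B::nat. \<forall>R::nat. real R \<le> 1 + L + \<delta> * (log 2 (6 * L * R + 1) + 3) \<longrightarrow> R \<le> B"
proof -
  \<comment> \<open>Strictly positive majorants spare the asymptotic comparison the degenerate cases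
    \<open>L = 0\<close> and \<open>\<delta> = 0\<close>.\<close>
  define K where "K = L + 1"
  define D where "D = \<delta> + 1"
  have KD: "K > 0" "D > 0" "L \<le> K" "\<delta> \<le> D" using assms by (auto simp: K_def D_def)
  have "eventually (\<lambda>x::real. 1 + K + D * (log 2 (6 * K * x + 1) + 3) < x) at_top"
    using KD by real_asymp
  then obtain B0 where B0: "\<And>x. x \<ge> B0 \<Longrightarrow> 1 + K + D * (log 2 (6 * K * x + 1) + 3) < x"
    unfolding eventually_at_top_linorder by blast
  have "R \<le> nat \<lceil>B0\<rceil>" if R: "real R \<le> 1 + L + \<delta> * (log 2 (6 * L * R + 1) + 3)" for R
  proof (rule ccontr)
    assume "\<not> ?thesis"
    then have "B0 \<le> real R" by linarith
    then have *: "1 + K + D * (log 2 (6 * K * R + 1) + 3) < R" by (rule B0)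
    have "6 * L * R \<le> 6 * K * R" "0 \<le> 6 * L * R" using KD assms by (auto intro: mult_right_mono)
    then have "log 2 (6 * L * R + 1) \<le> log 2 (6 * K * R + 1)" "0 \<le> log 2 (6 * L * R + 1)"
      by (auto simp: log_le_cancel_iff)
    then have "\<delta> * (log 2 (6 * L * R + 1) + 3) \<le> D * (log 2 (6 * K * R + 1) + 3)"
      using KD assms by (intro mult_mono) auto
    then show False using * R KD by linarith
  qed
  then show ?thesis by blast
qed

section \<open>Gromov hyperbolicity and geodesics\<close>

context Metric_space
begin

lemma gromov_product_commute: "gromov_product d e x y = gromov_product d e y x"
  by (simp add: gromov_product_def commute)

text \<open>By the triangle inequality \<open>d e y\<close> is at least
  \<open>d e x - d x y\<close>. Hence short steps taken far from \<open>e\<close> have a large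
  Gromov product.\<close>

lemma gromov_product_ge:
  assumes "e \<in> M" "x \<in> M" "y \<in> M"
  shows "d e x - d x y \<le> gromov_product d e x y"
  using triangle[of e y x] assms by (simp add: gromov_product_def commute field_simps)

text \<open>Each bisection of the chain costs one \<open>\<delta>\<close>, so \<open>n\<close> steps
  lose about \<open>log 2 n\<close> times \<open>\<delta>\<close> instead of \<open>n\<close> times
  \<open>\<delta>\<close>. This is the source of the logarithm.\<close>

lemma gromov_product_chain:
  assumes hyp: "\<And>e x y z. \<lbrakk>e \<in> M; x \<in> M; y \<in> M; z \<in> M\<rbrakk> \<Longrightarrow>
      min (gromov_product d e x y) (gromov_product d e y z) - \<delta> \<le> gromov_product d e x z"
    and "0 \<le> \<delta>" "e \<in> M"
    and "c ` {..n} \<subseteq> M" "0 < n" "n \<le> 2 ^ k"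
    and "\<And>i. i < n \<Longrightarrow> m \<le> gromov_product d e (c i) (c (Suc i))"
  shows "m - real k * \<delta> \<le> gromov_product d e (c 0) (c n)"
  using assms(4-)
proof (induction k arbitrary: c n)
  case 0
  then have "n = 1" by simp
  with 0 show ?case by simp
next
  case (Suc k)
  show ?case
  proof (cases "n \<le> 2 ^ k")
    case True
    with Suc have "m - real k * \<delta> \<le> gromov_product d e (c 0) (c n)" by blast
    with \<open>0 \<le> \<delta>\<close> show ?thesis by (simp add: algebra_simps)
  next
    case False
    define h where "h = (2::nat) ^ k"
    have h: "0 < h" "h < n" "n \<le> h + h" using False Suc.prems by (auto simp: h_def)
    have "m - real k * \<delta> \<le> gromov_product d e (c 0) (c h)"
      using Suc.prems h by (intro Suc.IH) (auto simp: h_def)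
    moreover have "m - real k * \<delta> \<le> gromov_product d e (c (h + 0)) (c (h + (n - h)))"
      using Suc.prems h by (intro Suc.IH[of "\<lambda>i. c (h + i)"]) (auto simp: h_def image_subset_iff)
    moreover have "c 0 \<in> M" "c h \<in> M" "c n \<in> M" using Suc.prems h by auto
    ultimately show ?thesis
      using hyp[of e "c 0" "c h" "c n"] \<open>e \<in> M\<close> h by (auto simp: algebra_simps)
  qed
qed

text \<open>If \<open>R\<close> is the largest distance from a point \<open>p\<close> of the geodesic to \<open>A\<close>, then the two
  points of the geodesic at distance \<open>2 R\<close> from \<open>p\<close> are joined through \<open>A\<close>, outside the ball
  of radius \<open>R\<close> around \<open>p\<close>, by a chain of length linear in \<open>R\<close>. Hyperbolicity forces such a
  chain to come within \<open>O(log R)\<close> of \<open>p\<close>, so \<open>R\<close> is bounded.\<close>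

lemma geodesic_near_undistorted:
  assumes "gromov_hyperbolic_on M d" and "0 \<le> L"
  shows "\<exists>B::nat. \<forall>A \<gamma> n. A \<subseteq> M \<longrightarrow> undistorted d L A \<longrightarrow> geodesic_path d n \<gamma> \<longrightarrow>
    \<gamma> ` {..n} \<subseteq> M \<longrightarrow> \<gamma> 0 \<in> A \<longrightarrow> \<gamma> n \<in> A \<longrightarrow> (\<forall>i\<le>n. \<exists>a\<in>A. d (\<gamma> i) a \<le> B)"
proof -
  obtain \<delta> where "0 \<le> \<delta>"
    and hyp: "\<And>e x y z. \<lbrakk>e \<in> M; x \<in> M; y \<in> M; z \<in> M\<rbrakk> \<Longrightarrow>
      min (gromov_product d e x y) (gromov_product d e y z) - \<delta> \<le> gromov_product d e x z"
    using assms(1) unfolding gromov_hyperbolic_on_def by blast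
  obtain B :: nat where
    B: "\<And>R::nat. real R \<le> 1 + L + \<delta> * (log 2 (6 * L * R + 1) + 3) \<Longrightarrow> R \<le> B"
    using linear_le_log_imp_bounded[OF \<open>0 \<le> L\<close> \<open>0 \<le> \<delta>\<close>] by blast
  have "\<forall>i\<le>n. \<exists>a\<in>A. d (\<gamma> i) a \<le> B"
    if A: "A \<subseteq> M" "undistorted d L A" and geo: "geodesic_path d n \<gamma>" "\<gamma> ` {..n} \<subseteq> M"
      and ends: "\<gamma> 0 \<in> A" "\<gamma> n \<in> A" for A \<gamma> n
  proof -
    have d\<gamma>: "d (\<gamma> i) (\<gamma> j) = \<bar>real i - real j\<bar>" if "i \<le> n" "j \<le> n" for i j
      using geo(1) that unfolding geodesic_path_def by blast
    have \<gamma>M: "\<gamma> i \<in> M" if "i \<le> n" for i using geo(2) that by auto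
    \<comment> \<open>With integer radii a least one exists; its minimality yields a vertex farther
      than \<open>R - 1\<close> from \<open>A\<close>.\<close>
    define Q where "Q R \<longleftrightarrow> (\<forall>i\<le>n. \<exists>a\<in>A. d (\<gamma> i) a \<le> real R)" for R :: nat
    define R where "R = (LEAST R. Q R)"
    have "Q n" unfolding Q_def using ends(1) d\<gamma> by force
    then have QR: "Q R" unfolding R_def by (rule LeastI)
    have "R \<le> B"
    proof (cases "R = 0")
      case False
      then have "\<not> Q (R - 1)" using not_less_Least[of "R - 1" Q] by (simp add: R_def)
      then obtain i where i: "i \<le> n" "\<And>a. a \<in> A \<Longrightarrow> real R - 1 < d (\<gamma> i) a"
        using False unfolding Q_def by (fastforce simp: not_le of_nat_diff)
      define p where "p = \<gamma> i"
      have p: "p \<in> M" using i \<gamma>M by (simp add: p_def)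
      \<comment> \<open>If \<open>\<gamma> j\<close> is at distance \<open>2 * R\<close> from
        \<open>p\<close> and \<open>a\<close> is within \<open>R\<close> of it, the product exceeds
        \<open>(2 * R + (R - 1) - R) / 2\<close>, that is \<open>R - 1/2\<close>. A vertex in
        \<open>A\<close> serves as its own \<open>a\<close>.\<close>
      have proj: "\<exists>a\<in>A. d (\<gamma> j) a \<le> R \<and> real R - 1 \<le> gromov_product d p (\<gamma> j) a"
        if j: "j \<le> n" "j + 2 * R = i \<or> i + 2 * R = j \<or> \<gamma> j \<in> A" for j
      proof (cases "\<gamma> j \<in> A")
        case True
        then show ?thesis
          using i(2)[OF True] A by (intro bexI[of _ "\<gamma> j"]) (auto simp: gromov_product_def p_def subset_iff)
      next
        case False
        obtain a where a: "a \<in> A" "d (\<gamma> j) a \<le> R" using QR j unfolding Q_def by blast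
        have "d p (\<gamma> j) = 2 * real R" using d\<gamma>[OF i(1) j(1)] j(2) False by (auto simp: p_def)
        then show ?thesis using i(2)[OF a(1)] a
          by (intro bexI[of _ a]) (auto simp: gromov_product_def p_def)
      qed
      \<comment> \<open>Where the geodesic ends before distance \<open>2 * R\<close>, truncation
        stops at its end point, which lies in \<open>A\<close>.\<close>
      define j1 j2 where "j1 = i - 2 * R" and "j2 = min n (i + 2 * R)"
      have j: "j1 \<le> i" "i \<le> j2" "j2 \<le> n" "i \<le> j1 + 2 * R" "j2 \<le> i + 2 * R"
        using i by (auto simp: j1_def j2_def)
      have "j1 = 0 \<or> j1 + 2 * R = i" by (auto simp: j1_def)
      then obtain a where a: "a \<in> A" "d (\<gamma> j1) a \<le> R" "real R - 1 \<le> gromov_product d p (\<gamma> j1) a"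
        using proj[of j1] j ends by auto
      have "j2 = n \<or> i + 2 * R = j2" by (auto simp: j2_def)
      then obtain b where b: "b \<in> A" "d (\<gamma> j2) b \<le> R" "real R - 1 \<le> gromov_product d p (\<gamma> j2) b"
        using proj[of j2] j ends by auto
      have M: "a \<in> M" "b \<in> M" "\<gamma> j1 \<in> M" "\<gamma> j2 \<in> M" using a b A \<gamma>M j by auto
      have "d (\<gamma> j1) (\<gamma> j2) \<le> 4 * real R" using d\<gamma>[of j1 j2] j by auto
      then have ab: "d a b \<le> 6 * real R"
        using triangle[of a "\<gamma> j1" b] triangle[of "\<gamma> j1" "\<gamma> j2" b] M a b by (simp add: commute)
      obtain c m where c: "c 0 = a" "c m = b" "c ` {..m} \<subseteq> A"
        "\<And>l. l < m \<Longrightarrow> d (c l) (c (Suc l)) \<le> L" "real m \<le> L * d a b"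
        using A(2) a(1) b(1) unfolding undistorted_def by meson
      have m6: "real m \<le> 6 * L * R" using c(5) mult_left_mono[OF ab \<open>0 \<le> L\<close>] by (simp add: mult_ac)
      \<comment> \<open>The chain has at most \<open>6 * L * R\<close> steps, so \<open>k\<close>
        halvings exhaust it; the summand 1 keeps the logarithm nonnegative.\<close>
      define k where "k = nat \<lceil>log 2 (6 * L * R + 1)\<rceil>"
      have LR: "0 \<le> 6 * L * R" using \<open>0 \<le> L\<close> by simp
      then have log0: "0 \<le> log 2 (6 * L * R + 1)" by simp
      then have k: "log 2 (6 * L * R + 1) \<le> k" "k \<le> log 2 (6 * L * R + 1) + 1"
        unfolding k_def by linarith+
      have "6 * L * R + 1 \<le> 2 ^ k"
        using k(1) LR by (subst (asm) log_le_iff) (auto simp: powr_realpow)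
      then have "real m \<le> 2 ^ k" using m6 by linarith
      then have m2k: "m \<le> 2 ^ k" by (metis of_nat_le_iff of_nat_numeral of_nat_power)
      have gab: "real R - 1 - L - k * \<delta> \<le> gromov_product d p a b"
      proof (cases "m = 0")
        case True
        have "gromov_product d p a a = d p a" using M by (simp add: gromov_product_def)
        moreover have "0 \<le> k * \<delta>" using \<open>0 \<le> \<delta>\<close> by simp
        moreover have "real R - 1 < d p a" using i(2)[OF a(1)] by (simp add: p_def)
        ultimately show ?thesis using True c \<open>0 \<le> L\<close> by simp
      next
        case False
        have "real R - 1 - L \<le> gromov_product d p (c l) (c (Suc l))" if l: "l < m" for l
        proof -
          have "c l \<in> A" "c (Suc l) \<in> A" using c(3) l by (auto simp: image_subset_iff)
          moreover from this have "c l \<in> M" "c (Suc l) \<in> M" using A(1) by auto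
          ultimately show ?thesis
            using gromov_product_ge[of p "c l" "c (Suc l)"] c(4)[OF l] i(2)[of "c l"] p
            by (simp add: p_def)
        qed
        then show ?thesis
          using gromov_product_chain[where c = c and n = m and k = k and e = p, OF hyp \<open>0 \<le> \<delta>\<close> p]
            c A False m2k by fastforce
      qed
      \<comment> \<open>As \<open>p\<close> lies on the geodesic between these vertices, their
        product is 0. The detour over \<open>a\<close> and \<open>b\<close>, at the cost of two more
        \<open>\<delta>\<close>, bounds it below by \<open>R\<close> minus a logarithmic
        term.\<close>
      have "gromov_product d p (\<gamma> j1) (\<gamma> j2) = 0"
        using d\<gamma>[of i j1] d\<gamma>[of i j2] d\<gamma>[of j1 j2] j by (simp add: gromov_product_def p_def)
      moreover have "min (gromov_product d p (\<gamma> j1) a) (gromov_product d p a b) - \<delta>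
          \<le> gromov_product d p (\<gamma> j1) b" using hyp M p by blast
      moreover have "min (gromov_product d p (\<gamma> j1) b) (gromov_product d p b (\<gamma> j2)) - \<delta>
          \<le> gromov_product d p (\<gamma> j1) (\<gamma> j2)" using hyp M p by blast
      moreover have "0 \<le> k * \<delta>" using \<open>0 \<le> \<delta>\<close> by simp
      ultimately have "real R \<le> 1 + L + k * \<delta> + 2 * \<delta>"
        using a(3) b(3) gab \<open>0 \<le> L\<close> \<open>0 \<le> \<delta>\<close> gromov_product_commute[of p b "\<gamma> j2"] by linarith
      also have "\<dots> = 1 + L + \<delta> * (k + 2)" by (simp add: algebra_simps)
      also have "\<dots> \<le> 1 + L + \<delta> * (log 2 (6 * L * R + 1) + 3)"
        using k(2) \<open>0 \<le> \<delta>\<close> by (simp add: mult_left_mono)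
      finally show ?thesis by (rule B)
    qed simp
    then show ?thesis using QR unfolding Q_def by (meson of_nat_le_iff order_trans)
  qed
  then show ?thesis by blast
qed

text \<open>Take the first \<open>t\<close> for which \<open>\<gamma> t\<close> is near some
  \<open>q j\<close> with \<open>i \<le> j\<close>. The vertex before it is near some
  \<open>q j'\<close> with \<open>j' < i\<close>. These points of \<open>q\<close> are at distance
  at most \<open>2 * B + 1\<close>, so \<open>comp\<close> bounds the gap from \<open>j'\<close> to
  \<open>j\<close>, which encloses \<open>i\<close>.\<close>

lemma near_geodesic_if_geodesic_near:
  assumes geo: "geodesic_path d n \<gamma>" "\<gamma> ` {..n} \<subseteq> M"
    and q: "q ` {..m} \<subseteq> M" "\<gamma> 0 = q 0" "\<gamma> n = q m"
    and near: "\<And>t. t \<le> n \<Longrightarrow> \<exists>j\<le>m. d (\<gamma> t) (q j) \<le> B"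
    and comp: "\<And>i j. \<lbrakk>i \<le> m; j \<le> m\<rbrakk> \<Longrightarrow> \<bar>real i - real j\<bar> \<le> L * d (q i) (q j)"
    and "0 \<le> L" "0 \<le> B" "i \<le> m"
  shows "\<exists>t\<le>n. \<exists>j\<le>m. d (\<gamma> t) (q j) \<le> B \<and> \<bar>real i - real j\<bar> \<le> L * (2 * B + 1)"
proof -
  have M: "\<gamma> t \<in> M" "q j \<in> M" if "t \<le> n" "j \<le> m" for t j using geo q that by auto
  define P where "P t \<longleftrightarrow> (\<exists>j\<le>m. i \<le> j \<and> d (\<gamma> t) (q j) \<le> B)" for t
  define t where "t = (LEAST t. P t)"
  have "P n" using q M \<open>0 \<le> B\<close> \<open>i \<le> m\<close> unfolding P_def by (intro exI[of _ m]) auto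
  then have "P t" "t \<le> n" unfolding t_def by (auto intro: LeastI Least_le)
  then obtain j where j: "j \<le> m" "i \<le> j" "d (\<gamma> t) (q j) \<le> B" unfolding P_def by blast
  have "\<bar>real i - real j\<bar> \<le> L * (2 * B + 1)"
  proof (cases t)
    \<comment> \<open>The common start \<open>q 0\<close> replaces the missing predecessor.\<close>
    case 0
    have "real j \<le> L * d (q 0) (q j)" using comp[of 0 j] j by simp
    also have "\<dots> \<le> L * (2 * B + 1)" using j 0 q \<open>0 \<le> L\<close> \<open>0 \<le> B\<close> by (intro mult_left_mono) auto
    finally show ?thesis using j by simp
  next
    case (Suc t')
    then obtain j' where j': "j' \<le> m" "d (\<gamma> t') (q j') \<le> B" using near[of t'] \<open>t \<le> n\<close> by auto
    have "\<not> P t'" using not_less_Least[of t' P] Suc by (simp add: t_def)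
    then have "j' < i" using j' unfolding P_def by (meson not_less)
    have "d (\<gamma> t') (\<gamma> t) = 1" using geo(1) Suc \<open>t \<le> n\<close> by (simp add: geodesic_path_def)
    then have "d (q j') (q j) \<le> 2 * B + 1"
      using triangle[of "q j'" "\<gamma> t'" "q j"] triangle[of "\<gamma> t'" "\<gamma> t" "q j"] M j j' Suc \<open>t \<le> n\<close>
        commute[of "q j'" "\<gamma> t'"] by auto
    then have "L * d (q j') (q j) \<le> L * (2 * B + 1)" using \<open>0 \<le> L\<close> by (rule mult_left_mono)
    then show ?thesis using comp[of j' j] j j' \<open>j' < i\<close> by auto
  qed
  with j \<open>t \<le> n\<close> show ?thesis by blast
qed

end

section \<open>Word metrics on Cayley graphs\<close>

locale word_metric = group G for G (structure) +
  fixes S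
  assumes generating: "symmetrized_generating_set G S"
begin

abbreviation wd :: "'a \<Rightarrow> 'a \<Rightarrow> real" where
  "wd x y \<equiv> real (cayley_dist G S x y)"

lemma generators_closed: "s \<in> S \<Longrightarrow> s \<in> carrier G"
  using generating by (auto simp: symmetrized_generating_set_def)

lemma edge_iff: "(x, y) \<in> cayley_graph G S \<longleftrightarrow> x \<in> carrier G \<and> (\<exists>s\<in>S. y = x \<otimes> s)"
  by (auto simp: cayley_graph_def)

lemma edge_sym:
  assumes "(x, y) \<in> cayley_graph G S"
  shows "(y, x) \<in> cayley_graph G S"
proof -
  obtain s where s: "x \<in> carrier G" "s \<in> S" "y = x \<otimes> s" using assms by (auto simp: edge_iff)
  moreover have "inv s \<in> S" using s generating by (simp add: symmetrized_generating_set_def)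
  moreover have "x = y \<otimes> inv s" using s generators_closed by (simp add: m_assoc)
  moreover have "y \<in> carrier G" using s generators_closed by simp
  ultimately show ?thesis unfolding edge_iff by blast
qed

lemma walk_sym: "(x, y) \<in> cayley_graph G S ^^ n \<Longrightarrow> (y, x) \<in> cayley_graph G S ^^ n"
proof (induction n arbitrary: y)
  case (Suc n)
  then obtain z where "(x, z) \<in> cayley_graph G S ^^ n" "(z, y) \<in> cayley_graph G S" by auto
  then show ?case using Suc.IH edge_sym relpow_Suc_I2 by metis
qed simp

lemma walk_translate:
  assumes "g \<in> carrier G"
  shows "(x, y) \<in> cayley_graph G S ^^ n \<Longrightarrow> (g \<otimes> x, g \<otimes> y) \<in> cayley_graph G S ^^ n"
proof (induction n arbitrary: y)
  case (Suc n)
  then obtain z where z: "(x, z) \<in> cayley_graph G S ^^ n" "(z, y) \<in> cayley_graph G S" by auto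
  then have "(g \<otimes> z, g \<otimes> y) \<in> cayley_graph G S"
    using assms generators_closed by (auto simp: edge_iff m_assoc)
  with z Suc.IH show ?case by auto
qed simp

text \<open>A word for \<open>inv x \<otimes> y\<close> is read as a walk starting at
  \<open>x\<close>. The existence of walks gives the \<open>LEAST\<close> in
  \<open>cayley_dist\<close> its meaning.\<close>

lemma connected:
  assumes "x \<in> carrier G" "y \<in> carrier G"
  shows "\<exists>n. (x, y) \<in> cayley_graph G S ^^ n"
proof -
  have inS: "inv s \<in> S" if "s \<in> S" for s
    using that generating by (simp add: symmetrized_generating_set_def)
  have sub: "generate G S \<subseteq> carrier G" using generating by (simp add: symmetrized_generating_set_def)
  \<comment> \<open>The start stays arbitrary because the second factor of a product is read from
    where the first one ends.\<close>
  have reach: "x \<in> carrier G \<Longrightarrow> (x, x \<otimes> w) \<in> (cayley_graph G S)\<^sup>*" if "w \<in> generate G S" for x w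
    using that
  proof (induction arbitrary: x)
    case (eng h1 h2)
    then have "h1 \<in> carrier G" "h2 \<in> carrier G" using sub by auto
    then show ?case using eng.IH(1)[of x] eng.IH(2)[of "x \<otimes> h1"] eng.prems by (simp add: m_assoc)
  next
    case (inv s)
    then show ?case using inS by (intro r_into_rtrancl) (auto simp: edge_iff intro!: bexI[of _ "inv s"])
  qed (auto simp: edge_iff intro!: r_into_rtrancl)
  have "inv x \<otimes> y \<in> generate G S"
    using assms generating by (simp add: symmetrized_generating_set_def)
  from reach[OF this assms(1)] show ?thesis using assms
    by (simp add: rtrancl_power m_assoc[symmetric])
qed

lemma walk_dist:
  assumes "x \<in> carrier G" "y \<in> carrier G"
  shows "(x, y) \<in> cayley_graph G S ^^ cayley_dist G S x y"
  unfolding cayley_dist_def using connected[OF assms] by (rule LeastI_ex)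

lemma dist_le_walk: "(x, y) \<in> cayley_graph G S ^^ n \<Longrightarrow> cayley_dist G S x y \<le> n"
  unfolding cayley_dist_def by (rule Least_le)

lemma dist_translate:
  assumes "g \<in> carrier G" "x \<in> carrier G" "y \<in> carrier G"
  shows "cayley_dist G S (g \<otimes> x) (g \<otimes> y) = cayley_dist G S x y"
proof (rule antisym)
  show "cayley_dist G S (g \<otimes> x) (g \<otimes> y) \<le> cayley_dist G S x y"
    using assms by (intro dist_le_walk walk_translate walk_dist)
  have "(inv g \<otimes> (g \<otimes> x), inv g \<otimes> (g \<otimes> y)) \<in> cayley_graph G S ^^ cayley_dist G S (g \<otimes> x) (g \<otimes> y)"
    using assms by (intro walk_translate walk_dist) auto
  then show "cayley_dist G S x y \<le> cayley_dist G S (g \<otimes> x) (g \<otimes> y)"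
    using assms by (intro dist_le_walk) (simp add: m_assoc[symmetric])
qed

sublocale Metric_space "carrier G" wd
proof
  fix x y z
  show "wd x y = wd y x"
    unfolding cayley_dist_def using walk_sym by (metis (no_types, lifting))
  show "wd x y = 0 \<longleftrightarrow> x = y" if "x \<in> carrier G" "y \<in> carrier G"
    using walk_dist[OF that] dist_le_walk[of x x 0] by auto
  show "wd x z \<le> wd x y + wd y z" if "x \<in> carrier G" "y \<in> carrier G" "z \<in> carrier G"
  proof -
    have "(x, z) \<in> cayley_graph G S ^^ (cayley_dist G S x y + cayley_dist G S y z)"
      using walk_dist[OF that(1,2)] walk_dist[OF that(2,3)] by (auto simp: relpow_add)
    from dist_le_walk[OF this] show ?thesis by linarith
  qed
qed simp

lemma dist_edge: "(x, y) \<in> cayley_graph G S \<Longrightarrow> wd x y \<le> 1"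
  using dist_le_walk[of x y 1] by simp

text \<open>The pieces up to \<open>i\<close>, from \<open>i\<close> to \<open>j\<close> and from
  \<open>j\<close> on span at most \<open>i\<close>, \<open>j - i\<close> and \<open>n - j\<close>.
  These bounds add up to the distance \<open>n\<close> of the end points, so each is
  attained.\<close>

lemma shortest_walk_geodesic:
  assumes walk: "\<And>i. i < n \<Longrightarrow> (\<gamma> i, \<gamma> (Suc i)) \<in> cayley_graph G S"
    and M: "\<gamma> ` {..n} \<subseteq> carrier G" and n: "n = cayley_dist G S (\<gamma> 0) (\<gamma> n)"
  shows "geodesic_path wd n \<gamma>"
proof -
  have \<gamma>M: "\<gamma> i \<in> carrier G" if "i \<le> n" for i using M that by auto
  have le: "wd (\<gamma> i) (\<gamma> (i + k)) \<le> k" if "i + k \<le> n" for i k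
    using that
  proof (induction k)
    case 0
    then show ?case using \<gamma>M by simp
  next
    case (Suc k)
    then show ?case
      using triangle[of "\<gamma> i" "\<gamma> (i + k)" "\<gamma> (Suc (i + k))"] \<gamma>M dist_edge[OF walk[of "i + k"]] by simp
  qed
  have eq: "wd (\<gamma> i) (\<gamma> j) = real j - real i" if "i \<le> j" "j \<le> n" for i j
  proof -
    have "wd (\<gamma> 0) (\<gamma> i) \<le> i" "wd (\<gamma> i) (\<gamma> j) \<le> real j - real i" "wd (\<gamma> j) (\<gamma> n) \<le> real n - real j"
      using le[of 0 i] le[of i "j - i"] le[of j "n - j"] that by auto
    moreover have "real n \<le> wd (\<gamma> 0) (\<gamma> i) + wd (\<gamma> i) (\<gamma> j) + wd (\<gamma> j) (\<gamma> n)"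
      using triangle[of "\<gamma> 0" "\<gamma> i" "\<gamma> n"] triangle[of "\<gamma> i" "\<gamma> j" "\<gamma> n"] \<gamma>M that n by force
    ultimately show ?thesis by linarith
  qed
  show ?thesis
    unfolding geodesic_path_def
  proof (intro allI impI)
    fix i j assume "i \<le> n" "j \<le> n"
    then show "wd (\<gamma> i) (\<gamma> j) = \<bar>real i - real j\<bar>"
      using eq[of i j] eq[of j i] commute[of "\<gamma> i" "\<gamma> j"] by (cases "i \<le> j") auto
  qed
qed

lemma geodesic_exists:
  assumes "x \<in> carrier G" "y \<in> carrier G"
  obtains \<gamma> where "\<gamma> 0 = x" "\<gamma> (cayley_dist G S x y) = y"
    "\<And>i. i < cayley_dist G S x y \<Longrightarrow> (\<gamma> i, \<gamma> (Suc i)) \<in> cayley_graph G S"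
    "\<gamma> ` {..cayley_dist G S x y} \<subseteq> carrier G" "geodesic_path wd (cayley_dist G S x y) \<gamma>"
proof -
  define n where "n = cayley_dist G S x y"
  obtain \<gamma> where \<gamma>: "\<gamma> 0 = x" "\<gamma> n = y" "\<And>i. i < n \<Longrightarrow> (\<gamma> i, \<gamma> (Suc i)) \<in> cayley_graph G S"
    using walk_dist[OF assms] by (auto simp: relpow_fun_conv n_def)
  have "\<gamma> i \<in> carrier G" if "i \<le> n" for i
    using that \<gamma> assms by (cases "i = n") (auto simp: edge_iff)
  then have M: "\<gamma> ` {..n} \<subseteq> carrier G" by auto
  have "geodesic_path wd n \<gamma>"
    using \<gamma> M by (intro shortest_walk_geodesic) (auto simp: n_def)
  with that \<gamma> M show thesis unfolding n_def by blast
qed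

lemma cayley_geodesic_path:
  assumes "cayley_geodesic G S x p y"
  shows "geodesic_path wd (cayley_dist G S x y) ((!) p)"
    and "p ! 0 = x" "p ! cayley_dist G S x y = y"
    and "set p = (!) p ` {..cayley_dist G S x y}"
proof -
  define n where "n = cayley_dist G S x y"
  have p: "p \<noteq> []" "set p \<subseteq> carrier G" "hd p = x" "last p = y" "length p = Suc n"
    and succ: "successively (\<lambda>u v. (u, v) \<in> cayley_graph G S) p"
    using assms by (auto simp: cayley_geodesic_def n_def)
  have set: "set p = (!) p ` {..n}" using p(5) by (auto simp: set_conv_nth less_Suc_eq_le)
  have ends: "p ! 0 = x" "p ! n = y" using p by (auto simp: hd_conv_nth last_conv_nth)
  have "geodesic_path wd n ((!) p)"
    using p set ends successively_nth[OF succ] by (intro shortest_walk_geodesic) (auto simp: n_def)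
  with set ends show "geodesic_path wd (cayley_dist G S x y) ((!) p)"
    "p ! 0 = x" "p ! cayley_dist G S x y = y" "set p = (!) p ` {..cayley_dist G S x y}"
    by (simp_all add: n_def)
qed

lemma lipschitz_if_edges:
  assumes "Metric_space M e" "f ` carrier G \<subseteq> M"
    and L: "\<And>u v. (u, v) \<in> cayley_graph G S \<Longrightarrow> e (f u) (f v) \<le> L"
    and "x \<in> carrier G" "y \<in> carrier G"
  shows "e (f x) (f y) \<le> L * wd x y"
proof -
  interpret E: Metric_space M e by fact
  have "e (f x) (f y) \<le> L * n" if "(x, y) \<in> cayley_graph G S ^^ n" "y \<in> carrier G" for n y
    using that
  proof (induction n arbitrary: y)
    case 0
    then show ?case using assms(2,4) by auto
  next
    case (Suc n)
    then obtain z where z: "(x, z) \<in> cayley_graph G S ^^ n" "(z, y) \<in> cayley_graph G S" by auto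
    then have "z \<in> carrier G" by (simp add: edge_iff)
    then show ?case
      using Suc.IH[OF z(1) \<open>z \<in> carrier G\<close>] L[OF z(2)] E.triangle[of "f x" "f z" "f y"] assms(2,4) Suc.prems
      by (force simp: algebra_simps image_subset_iff)
  qed
  from this[OF walk_dist] show ?thesis using assms(4,5) by blast
qed

text \<open>A word metric is a left-invariant function, so it is bounded on the edges of another Cayley
  graph of the group as soon as that graph has finitely many labels.\<close>

lemma word_metric_comparison:
  assumes "finite T" "symmetrized_generating_set G T"
  shows "\<exists>L\<ge>1. \<forall>x\<in>carrier G. \<forall>y\<in>carrier G. wd x y \<le> L * real (cayley_dist G T x y)"
proof -
  interpret T: word_metric G T using assms by unfold_locales
  define L where "L = Max (insert 1 (wd \<one> ` T))"
  have "wd u v \<le> L" if "(u, v) \<in> cayley_graph G T" for u v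
  proof -
    obtain t where t: "u \<in> carrier G" "t \<in> T" "v = u \<otimes> t" using \<open>(u, v) \<in> _\<close> by (auto simp: T.edge_iff)
    then have "wd u v = wd \<one> t" using dist_translate[of u \<one> t] T.generators_closed by simp
    then show ?thesis using assms(1) t by (auto simp: L_def)
  qed
  then have "wd x y \<le> L * T.wd x y" if "x \<in> carrier G" "y \<in> carrier G" for x y
    using T.lipschitz_if_edges[of "carrier G" wd "\<lambda>x. x" L x y] that Metric_space_axioms by simp
  moreover have "L \<ge> 1" using assms(1) by (simp add: L_def)
  ultimately show ?thesis by blast
qed

text \<open>The retraction maps a geodesic of the ambient group to a chain in \<open>A\<close> with
  as many steps, and fixes its end points.\<close>

lemma undistorted_retract:
  assumes "A \<subseteq> carrier G" "\<And>g. g \<in> carrier G \<Longrightarrow> r g \<in> A" "\<And>a. a \<in> A \<Longrightarrow> r a = a"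
    and "\<And>u v. (u, v) \<in> cayley_graph G S \<Longrightarrow> wd (r u) (r v) \<le> L" and "1 \<le> L"
  shows "undistorted wd L A"
  unfolding undistorted_def
proof (intro ballI)
  fix a b assume ab: "a \<in> A" "b \<in> A"
  then have "a \<in> carrier G" "b \<in> carrier G" using assms(1) by auto
  then obtain \<gamma> where \<gamma>: "\<gamma> 0 = a" "\<gamma> (cayley_dist G S a b) = b"
    "\<And>i. i < cayley_dist G S a b \<Longrightarrow> (\<gamma> i, \<gamma> (Suc i)) \<in> cayley_graph G S"
    "\<gamma> ` {..cayley_dist G S a b} \<subseteq> carrier G" by (rule geodesic_exists) blast
  have "wd a b \<le> L * wd a b" using assms(5) mult_right_mono[of 1 L "wd a b"] by simp
  then show "\<exists>c n. c 0 = a \<and> c n = b \<and> c ` {..n} \<subseteq> A \<and>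
     (\<forall>i<n. wd (c i) (c (Suc i)) \<le> L) \<and> real n \<le> L * wd a b"
    using \<gamma> assms ab
    by (intro exI[of _ "r \<circ> \<gamma>"] exI[of _ "cayley_dist G S a b"]) (auto simp: image_subset_iff)
qed

end

text \<open>Successive vertices of \<open>q\<close> form the chain. The first comparison bounds its
  length, an index difference, by the \<open>d\<close>-distance; the second bounds its steps. In the
  application \<open>d\<close> is the hyperbolic metric and \<open>e\<close> that of the given
  generators.\<close>

lemma undistorted_geodesic_image:
  assumes geo: "geodesic_path e n q"
    and comp: "\<And>i j. \<lbrakk>i \<le> n; j \<le> n\<rbrakk> \<Longrightarrow> e (q i) (q j) \<le> L * d (q i) (q j)"
      "\<And>i j. \<lbrakk>i \<le> n; j \<le> n\<rbrakk> \<Longrightarrow> d (q i) (q j) \<le> L * e (q i) (q j)"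
  shows "undistorted d L (q ` {..n})"
  unfolding undistorted_def
proof (intro ballI)
  fix a b assume "a \<in> q ` {..n}" "b \<in> q ` {..n}"
  then obtain i j where ij: "i \<le> n" "j \<le> n" "a = q i" "b = q j" by auto
  have e: "e (q k) (q l) = \<bar>real k - real l\<bar>" if "k \<le> n" "l \<le> n" for k l
    using geo that unfolding geodesic_path_def by blast
  have step: "d (q k) (q l) \<le> L" if "k \<le> n" "l \<le> n" "l = Suc k \<or> k = Suc l" for k l
    using comp(2)[of k l] e[of k l] that by auto
  have len: "\<bar>real i - real j\<bar> \<le> L * d a b" using comp(1)[of i j] e[of i j] ij by simp
  show "\<exists>c m. c 0 = a \<and> c m = b \<and> c ` {..m} \<subseteq> q ` {..n} \<and>
     (\<forall>i<m. d (c i) (c (Suc i)) \<le> L) \<and> real m \<le> L * d a b"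
  proof (cases "i \<le> j")
    case True
    then show ?thesis using ij step len
      by (intro exI[of _ "\<lambda>k. q (i + k)"] exI[of _ "j - i"]) auto
  next
    case False
    have "d (q (i - k)) (q (i - Suc k)) \<le> L" if "k < i - j" for k
      using that ij by (intro step) auto
    with False show ?thesis using ij len
      by (intro exI[of _ "\<lambda>k. q (i - k)"] exI[of _ "i - j"]) auto
  qed
qed

section \<open>Cosets and the retraction onto a quasiretract\<close>

context group
begin

text \<open>Two elements of \<open>H\<close> in the same left coset of \<open>N\<close> differ by an
  element of \<open>H \<inter> N\<close>, so the intersection lies in a translate of
  \<open>H \<inter> N\<close> by any one of its elements.\<close>

lemma finite_Int_l_coset:
  assumes "subgroup H G" "subgroup N G" "finite (H \<inter> N)" "u \<in> carrier G"
  shows "finite (H \<inter> (u <# N))"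
proof (cases "H \<inter> (u <# N) = {}")
  case False
  then obtain k where k: "k \<in> H" "k \<in> u <# N" by blast
  have sub: "H \<subseteq> carrier G" "N \<subseteq> carrier G" using assms subgroup.subset by auto
  have "x \<in> (\<lambda>f. k \<otimes> f) ` (H \<inter> N)" if x: "x \<in> H" "x \<in> u <# N" for x
  proof
    obtain n1 n2 where n: "n1 \<in> N" "n2 \<in> N" "k = u \<otimes> n1" "x = u \<otimes> n2"
      using k x by (auto simp: l_coset_def)
    then have "inv k \<otimes> x = inv n1 \<otimes> n2"
      using assms(4) sub by (auto simp: inv_mult_group m_assoc subset_iff inv_solve_left')
    moreover have "inv k \<otimes> x \<in> H" using k x assms(1) by (simp add: subgroup.m_closed subgroup.m_inv_closed)
    ultimately show "inv k \<otimes> x \<in> H \<inter> N"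
      using n assms(2) by (simp add: subgroup.m_closed subgroup.m_inv_closed)
    show "x = k \<otimes> (inv k \<otimes> x)" using k x sub by (auto simp: m_assoc[symmetric] subset_iff)
  qed
  then have "H \<inter> (u <# N) \<subseteq> (\<lambda>f. k \<otimes> f) ` (H \<inter> N)" by blast
  with assms(3) show ?thesis by (meson finite_imageI finite_subset)
qed simp

lemma finite_index_transversal:
  assumes "subgroup K G" "finite (rcosets K)"
  shows "\<exists>T. finite T \<and> T \<subseteq> carrier G \<and> (\<forall>g\<in>carrier G. \<exists>k\<in>K. \<exists>t\<in>T. g = k \<otimes> t)"
proof (intro exI[of _ "(\<lambda>C. SOME t. t \<in> C) ` (rcosets K)"] conjI ballI)
  have some: "(SOME t. t \<in> K #> g) \<in> K #> g" if "g \<in> carrier G" for g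
    using rcos_self[OF that assms(1)] by (rule someI)
  have KG: "K \<subseteq> carrier G" using assms(1) by (rule subgroup.subset)
  show "finite ((\<lambda>C. SOME t. t \<in> C) ` (rcosets K))" using assms(2) by simp
  show "(\<lambda>C. SOME t. t \<in> C) ` (rcosets K) \<subseteq> carrier G"
    using some r_coset_subset_G[OF KG] by (fastforce simp: RCOSETS_def)
  fix g assume g: "g \<in> carrier G"
  then obtain k where k: "k \<in> K" "(SOME t. t \<in> K #> g) = k \<otimes> g"
    using some[OF g] by (auto simp: r_coset_def)
  then have "g = inv k \<otimes> (SOME t. t \<in> K #> g)" using g KG by (auto simp: m_assoc[symmetric])
  moreover have "inv k \<in> K" using k assms(1) by (simp add: subgroup.m_inv_closed)
  moreover have "K #> g \<in> rcosets K" using g by (auto simp: RCOSETS_def)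
  ultimately show "\<exists>k\<in>K. \<exists>t\<in>(\<lambda>C. SOME t. t \<in> C) ` (rcosets K). g = k \<otimes> t" by blast
qed

end

text \<open>Write each \<open>g\<close> as \<open>h n t\<close> with \<open>h\<close> in \<open>H\<close>, \<open>n\<close> in \<open>N\<close> and \<open>t\<close> in a finite
  transversal, and retract \<open>g\<close> to \<open>h\<close>. If \<open>g s = h' n' t'\<close>, then \<open>h\<^sup>-\<^sup>1 h' = n (t s t'\<^sup>-\<^sup>1) n'\<^sup>-\<^sup>1\<close>
  lies in one of finitely many cosets of \<open>N\<close>, each of which has finite intersection with \<open>H\<close>.\<close>

lemma (in word_metric) quasiretract_retraction:
  assumes "finite S" "quasiretract G H"
  shows "\<exists>r L. (\<forall>g\<in>carrier G. r g \<in> H) \<and> (\<forall>h\<in>H. r h = h) \<and>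
    (\<forall>u v. (u, v) \<in> cayley_graph G S \<longrightarrow> wd (r u) (r v) \<le> L)"
proof -
  obtain N where H: "subgroup H G" and N: "N \<lhd> G" and fin: "finite (rcosets (H <#> N))" "finite (H \<inter> N)"
    using assms(2) by (auto simp: quasiretract_def)
  have NG: "subgroup N G" using N by (rule normal_imp_subgroup)
  note sub = subgroup.subset[OF H] subgroup.subset[OF NG]
  have "subgroup (H <#> N) G" using mult_norm_subgroup[OF N H] commut_normal[OF H N] by simp
  from finite_index_transversal[OF this fin(1)] obtain T0 where T0: "finite T0" "T0 \<subseteq> carrier G"
    "\<And>g. g \<in> carrier G \<Longrightarrow> \<exists>k\<in>H <#> N. \<exists>t\<in>T0. g = k \<otimes> t" by blast
  \<comment> \<open>With \<open>\<one>\<close> in \<open>T\<close>, every \<open>h\<close> in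
    \<open>H\<close> decomposes as \<open>h \<otimes> \<one> \<otimes> \<one>\<close>, so
    \<open>r\<close> can fix \<open>H\<close> pointwise and still satisfy \<open>P\<close>.\<close>
  define T where "T = insert \<one> T0"
  have T: "finite T" "T \<subseteq> carrier G" using T0 by (auto simp: T_def)
  define P where "P g h \<longleftrightarrow> h \<in> H \<and> (\<exists>n\<in>N. \<exists>t\<in>T. g = h \<otimes> n \<otimes> t)" for g h
  have ex: "\<exists>h. P g h" if "g \<in> carrier G" for g
  proof -
    obtain k t where "k \<in> H <#> N" "t \<in> T0" "g = k \<otimes> t" using T0(3)[OF \<open>g \<in> carrier G\<close>] by blast
    moreover from this obtain h n where "h \<in> H" "n \<in> N" "k = h \<otimes> n" by (auto simp: set_mult_def)
    ultimately show ?thesis unfolding P_def T_def by blast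
  qed
  have self: "P h h" if "h \<in> H" for h
    using that sub subgroup.one_closed[OF NG] unfolding P_def T_def by (force intro!: bexI[of _ \<one>])
  define r where "r g = (if g \<in> H then g else SOME h. P g h)" for g
  have r: "P g (r g)" if "g \<in> carrier G" for g
    using ex[OF that] self by (auto simp: r_def intro: someI)
  define U where "U = (\<lambda>(t, s, t'). t \<otimes> s \<otimes> inv t') ` (T \<times> S \<times> T)"
  define F where "F = (\<Union>u\<in>U. H \<inter> (u <# N))"
  have UG: "U \<subseteq> carrier G" using T generators_closed by (auto simp: U_def)
  have "finite U" using assms(1) T by (simp add: U_def)
  then have "finite F" using finite_Int_l_coset[OF H NG fin(2)] UG unfolding F_def by blast
  have key: "inv h \<otimes> h' \<in> F" if P: "P g h" "P (g \<otimes> s) h'" and g: "g \<in> carrier G" and s: "s \<in> S" for g s h h'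
  proof -
    obtain n t where nt: "h \<in> H" "n \<in> N" "t \<in> T" "g = h \<otimes> n \<otimes> t" using P(1) by (auto simp: P_def)
    obtain n' t' where nt': "h' \<in> H" "n' \<in> N" "t' \<in> T" "g \<otimes> s = h' \<otimes> n' \<otimes> t'"
      using P(2) by (auto simp: P_def)
    have cl: "h \<in> carrier G" "n \<in> carrier G" "t \<in> carrier G" "s \<in> carrier G"
      "h' \<in> carrier G" "n' \<in> carrier G" "t' \<in> carrier G"
      using nt nt' sub T generators_closed s by auto
    define u where "u = t \<otimes> s \<otimes> inv t'"
    have u: "u \<in> U" "u \<in> carrier G" using nt nt' s cl by (force simp: U_def u_def)+
    have "h \<otimes> (n \<otimes> u) = (h \<otimes> n \<otimes> t \<otimes> s) \<otimes> inv t'" using cl by (simp add: u_def m_assoc)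
    also have "\<dots> = h' \<otimes> n'" using nt nt' cl by (simp add: m_assoc)
    finally have "h' = h \<otimes> (n \<otimes> u \<otimes> inv n')" using cl u by (simp add: m_assoc[symmetric] inv_solve_right)
    then have "inv h \<otimes> h' = n \<otimes> u \<otimes> inv n'" using cl u by (simp add: m_assoc[symmetric])
    \<comment> \<open>Normality moves \<open>n\<close> to the right of \<open>u\<close> as a
      conjugate in \<open>N\<close>, which exhibits the coset \<open>u <# N\<close>.\<close>
    moreover have "n \<otimes> u \<otimes> inv n' = u \<otimes> ((inv u \<otimes> n \<otimes> u) \<otimes> inv n')"
      using cl u by (simp add: m_assoc[symmetric])
    moreover have "(inv u \<otimes> n \<otimes> u) \<otimes> inv n' \<in> N"
      using N NG nt nt' u by (simp add: normal.inv_op_closed1 subgroup.m_closed subgroup.m_inv_closed)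
    ultimately have "inv h \<otimes> h' \<in> u <# N" unfolding l_coset_def by auto
    moreover have "inv h \<otimes> h' \<in> H" using H nt nt' by (simp add: subgroup.m_closed subgroup.m_inv_closed)
    ultimately show ?thesis using u unfolding F_def by blast
  qed
  \<comment> \<open>\<open>F\<close> is finite, and left invariance turns each distance to be
    bounded into one from \<open>\<one>\<close> to an element of \<open>F\<close>.\<close>
  define L where "L = Max (insert 0 (wd \<one> ` F))"
  have "wd (r u) (r v) \<le> L" if uv: "(u, v) \<in> cayley_graph G S" for u v
  proof -
    obtain s where s: "u \<in> carrier G" "s \<in> S" "v = u \<otimes> s" using uv by (auto simp: edge_iff)
    have P: "P u (r u)" "P v (r v)" using r s generators_closed by auto
    then have rG: "r u \<in> carrier G" "r v \<in> carrier G" using sub by (auto simp: P_def)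
    have "wd (r u) (r v) = wd (inv (r u) \<otimes> r u) (inv (r u) \<otimes> r v)"
      using rG by (simp only: dist_translate inv_closed)
    also have "\<dots> = wd \<one> (inv (r u) \<otimes> r v)" using rG by simp
    also have "\<dots> \<le> L" using key[of u "r u" s "r v"] P s \<open>finite F\<close> by (simp add: L_def)
    finally show ?thesis .
  qed
  moreover have "\<forall>g\<in>carrier G. r g \<in> H" using r by (auto simp: P_def)
  moreover have "\<forall>h\<in>H. r h = h" by (simp add: r_def)
  ultimately show ?thesis by blast
qed

section \<open>Quasiconvexity for an arbitrary finite generating set\<close>

theorem lemma1p2:
  fixes G :: "('a, 'b) monoid_scheme" and S H :: "'a set"
  assumes "hyperbolic_group G"
    and "finite S" and "symmetrized_generating_set G S"
    and "quasiretract G H"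
  shows "quasiconvex G S H"
proof -
  obtain S0 where S0: "group G" "finite S0" "symmetrized_generating_set G S0"
    "gromov_hyperbolic_on (carrier G) (\<lambda>x y. real (cayley_dist G S0 x y))"
    using assms(1) by (auto simp: hyperbolic_group_def)
  interpret W0: word_metric G S0 using S0 by (simp add: word_metric_def word_metric_axioms_def)
  interpret W: word_metric G S using S0 assms(3) by (simp add: word_metric_def word_metric_axioms_def)
  have HG: "H \<subseteq> carrier G" using assms(4) by (auto simp: quasiretract_def subgroup.subset)
  obtain L1 where L1: "\<And>x y. \<lbrakk>x \<in> carrier G; y \<in> carrier G\<rbrakk> \<Longrightarrow> W.wd x y \<le> L1 * W0.wd x y"
    using W.word_metric_comparison[OF S0(2,3)] by blast
  obtain L2 where L2: "\<And>x y. \<lbrakk>x \<in> carrier G; y \<in> carrier G\<rbrakk> \<Longrightarrow> W0.wd x y \<le> L2 * W.wd x y"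
    using W0.word_metric_comparison[OF assms(2,3)] by blast
  obtain r L3 where r: "\<And>g. g \<in> carrier G \<Longrightarrow> r g \<in> H" "\<And>h. h \<in> H \<Longrightarrow> r h = h"
    and L3: "\<And>u v. (u, v) \<in> cayley_graph G S0 \<Longrightarrow> W0.wd (r u) (r v) \<le> L3"
    using W0.quasiretract_retraction[OF S0(2) assms(4)] by blast
  \<comment> \<open>One constant for both metric comparisons and the retraction; the entry 1 meets
    the requirement of \<open>undistorted_retract\<close>.\<close>
  define L where "L = Max {1, L1, L2, L3}"
  have L: "1 \<le> L" "L1 \<le> L" "L2 \<le> L" "L3 \<le> L" by (auto simp: L_def)
  have W_le: "W.wd x y \<le> L * W0.wd x y" if "x \<in> carrier G" "y \<in> carrier G" for x y
    using L1[OF that] mult_right_mono[OF L(2), of "W0.wd x y"] by simp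
  have W0_le: "W0.wd x y \<le> L * W.wd x y" if "x \<in> carrier G" "y \<in> carrier G" for x y
    using L2[OF that] mult_right_mono[OF L(3), of "W.wd x y"] by simp
  have undH: "undistorted W0.wd L H"
    using HG r order_trans[OF L3 L(4)] L(1) by (rule W0.undistorted_retract)
  \<comment> \<open>\<open>B\<close> is chosen before the set \<open>A\<close>, so it serves
    \<open>H\<close> and all \<open>S\<close>-geodesics alike.\<close>
  obtain B :: nat where B: "\<And>A \<gamma> n i. \<lbrakk>A \<subseteq> carrier G; undistorted W0.wd L A; geodesic_path W0.wd n \<gamma>;
      \<gamma> ` {..n} \<subseteq> carrier G; \<gamma> 0 \<in> A; \<gamma> n \<in> A; i \<le> n\<rbrakk> \<Longrightarrow> \<exists>a\<in>A. W0.wd (\<gamma> i) a \<le> B"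
    using W0.geodesic_near_undistorted[OF S0(4), of L] L(1) by (meson order_trans zero_le_one)
  \<comment> \<open>The summands bound, in the metric of \<open>S\<close>, the way from
    \<open>z\<close> along the \<open>S\<close>-geodesic to \<open>q j\<close> and the way from
    \<open>q j\<close> to \<open>h\<close>. The latter passes by \<open>\<gamma> t\<close> and is at
    most \<open>2 * B\<close> in the metric of \<open>S0\<close>.\<close>
  define \<eta> where "\<eta> = L * (2 * real B + 1) + L * (2 * real B)"
  have "\<exists>h\<in>H. W.wd z h \<le> \<eta>"
    if xy: "x \<in> H" "y \<in> H" and p: "cayley_geodesic G S x p y" and z: "z \<in> set p" for x y p z
  proof -
    define m q where "m = cayley_dist G S x y" and "q = (!) p"
    have q: "geodesic_path W.wd m q" "q 0 = x" "q m = y" "set p = q ` {..m}"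
      using W.cayley_geodesic_path[OF p] by (simp_all add: m_def q_def)
    have pG: "q ` {..m} \<subseteq> carrier G" using p q(4) by (simp add: cayley_geodesic_def)
    then have qG: "q i \<in> carrier G" if "i \<le> m" for i using that by auto
    have dq: "W.wd (q i) (q j) = \<bar>real i - real j\<bar>" if "i \<le> m" "j \<le> m" for i j
      using q(1) that unfolding geodesic_path_def by blast
    have undq: "undistorted W0.wd L (q ` {..m})"
      using W_le W0_le qG by (intro undistorted_geodesic_image[OF q(1)]) auto
    define n where "n = cayley_dist G S0 x y"
    have "x \<in> carrier G" "y \<in> carrier G" using xy HG by auto
    then obtain \<gamma> where \<gamma>: "\<gamma> 0 = x" "\<gamma> n = y" "\<gamma> ` {..n} \<subseteq> carrier G" "geodesic_path W0.wd n \<gamma>"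
      unfolding n_def by (rule W0.geodesic_exists) simp
    obtain i where i: "i \<le> m" "z = q i" using z q by auto
    have "x \<in> q ` {..m}" "y \<in> q ` {..m}" using q(2,3) by force+
    then have near: "\<exists>j\<le>m. W0.wd (\<gamma> t) (q j) \<le> real B" if "t \<le> n" for t
      using B[OF pG undq \<gamma>(4,3) _ _ that] \<gamma>(1,2) by auto
    have comp: "\<bar>real i - real j\<bar> \<le> L * W0.wd (q i) (q j)" if "i \<le> m" "j \<le> m" for i j
      using W_le[of "q i" "q j"] qG dq that by simp
    obtain t j where tj: "t \<le> n" "j \<le> m" "W0.wd (\<gamma> t) (q j) \<le> B" "\<bar>real i - real j\<bar> \<le> L * (2 * real B + 1)"
      using W0.near_geodesic_if_geodesic_near[OF \<gamma>(4,3) pG _ _ near comp _ _ i(1)] q(2,3) \<gamma>(1,2) L(1) by auto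
    obtain h where h: "h \<in> H" "W0.wd (\<gamma> t) h \<le> B"
      using B[OF HG undH \<gamma>(4,3) _ _ tj(1)] \<gamma>(1,2) xy by auto
    have G: "\<gamma> t \<in> carrier G" "q j \<in> carrier G" "h \<in> carrier G" "z \<in> carrier G"
      using \<gamma> tj qG h HG i by auto
    have "W0.wd (q j) h \<le> 2 * real B"
      using W0.triangle[of "q j" "\<gamma> t" h] W0.commute[of "q j" "\<gamma> t"] G tj h by simp
    then have "L * W0.wd (q j) h \<le> L * (2 * real B)" using L(1) by (intro mult_left_mono) auto
    then have "W.wd (q j) h \<le> L * (2 * real B)" using W_le[of "q j" h] G by simp
    moreover have "W.wd z (q j) \<le> L * (2 * real B + 1)" using dq[of i j] tj i by simp
    ultimately have "W.wd z h \<le> \<eta>" using W.triangle[of z "q j" h] G unfolding \<eta>_def by linarith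
    with h show ?thesis by blast
  qed
  moreover have "0 \<le> \<eta>" using L(1) by (simp add: \<eta>_def)
  ultimately show ?thesis
    using HG unfolding quasiconvex_def closed_nbhd_def cayley_geodesic_def
    by (intro conjI exI[of _ \<eta>] allI ballI impI subsetI) auto
qed

end
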